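(* Let $n \geqslant m \geqslant 1$ be integers, let $\sigma^m = [\upsilon^0, \upsilon^1, \ldots, \upsilon^m]$ be a regular $m$-simplex in $\mathbb{R}^n$, and for $i=0,\ldots,m$ let $\kappa_i^m$ be the barycenter of the $i$-th $(m-1)$-face of $\sigma^m$ opposite to the vertex $\upsilon^i$. Then $$\|\upsilon^i-\kappa_i^m\|^2 + \|\upsilon^j-\kappa_i^m\|^2 = \|\upsilon^i-\upsilon^j\|^2,\qquad i,j=0,1,\ldots,m,\ j\neq i.$$
   Context: An $m$-simplex $[\upsilon^0,\ldots,\upsilon^m]$ in $\mathbb{R}^n$ is the convex hull of $m+1$ affinely independent points (its vertices). It is regular if all its edges (segments joining two vertices) have the same length. The $i$-th $(m-1)$-face is the convex hull of all vertices except $\upsilon^i$, and its barycenter is $\kappa_i^m = \frac1m\sum_{j\neq i}\upsilon^j$. $\|\cdot\|$ is the Euclidean norm. *)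

theory Defs
  imports "HOL-Analysis.Analysis"
begin

(* An m-simplex with labelled vertices v 0, ..., v m; values of v beyond m are irrelevant.
   The predicate affine_dependent is about sets, so injectivity is needed to say that the
   m + 1 points of the family are affinely independent. *)
definition simplex_with_vertices :: "nat \<Rightarrow> (nat \<Rightarrow> 'a::euclidean_space) \<Rightarrow> 'a set \<Rightarrow> bool"
  where "simplex_with_vertices m v S \<longleftrightarrow>
    inj_on v {..m} \<and> \<not> affine_dependent (v ` {..m}) \<and> S = convex hull (v ` {..m})"

(* The length of the edge joining v i and v j is dist (v i) (v j). *)
definition regular_simplex_with_vertices ::
    "nat \<Rightarrow> (nat \<Rightarrow> 'a::euclidean_space) \<Rightarrow> 'a set \<Rightarrow> bool"
  where "regular_simplex_with_vertices m v S \<longleftrightarrow>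
    simplex_with_vertices m v S \<and>
    (\<exists>l. \<forall>i\<le>m. \<forall>j\<le>m. i \<noteq> j \<longrightarrow> dist (v i) (v j) = l)"

(* Barycenter of the face opposite to v i; meaningful for m \<ge> 1 and i \<le> m. *)
definition face_barycenter :: "nat \<Rightarrow> (nat \<Rightarrow> 'a::euclidean_space) \<Rightarrow> nat \<Rightarrow> 'a"
  where "face_barycenter m v i = (1 / real m) *\<^sub>R (\<Sum>j\<in>{..m} - {i}. v j)"

end

(* The altitude from v i to the opposite face is orthogonal to each edge v j - v k of that face:
   by polarization, the sum over the face vertices v p of (v i - v p) \<bullet> (v j - v k) is half the
   difference of the sums of squared distances from v j and from v k to the face vertices, and all
   these sums are equal. So the triangle with corners v i, v j and the barycenter has a right angle
   at the barycenter, and the claim is the theorem of Pythagoras. *)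
theory Submission
  imports Defs
begin

lemma inner_diff_diff:
  fixes a b c d :: "'a::real_inner"
  shows "(a - b) \<bullet> (c - d) =
    ((dist a d)\<^sup>2 + (dist b c)\<^sup>2 - (dist a c)\<^sup>2 - (dist b d)\<^sup>2) / 2"
  by (simp add: dist_norm power2_norm_eq_inner inner_diff inner_commute)

text \<open>The term \<open>p = j\<close> vanishes and each of the other \<open>card I - 1\<close>
  terms is \<open>l\<^sup>2\<close>, so the sum is the same for every \<open>j\<close> in
  \<open>I\<close>.\<close>

lemma sum_dist_square_equidistant:
  fixes v :: "'i \<Rightarrow> 'a::metric_space"
  assumes "finite I" "j \<in> I"
    and "\<And>p q. p \<in> I \<Longrightarrow> q \<in> I \<Longrightarrow> p \<noteq> q \<Longrightarrow> dist (v p) (v q) = l"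
  shows "(\<Sum>p\<in>I. (dist (v p) (v j))\<^sup>2) = real (card I - 1) * l\<^sup>2"
proof -
  have "(\<Sum>p\<in>I. (dist (v p) (v j))\<^sup>2) = (\<Sum>p\<in>I - {j}. (dist (v p) (v j))\<^sup>2)"
    using assms(1,2) by (simp add: sum.remove)
  also have "\<dots> = (\<Sum>p\<in>I - {j}. l\<^sup>2)"
    using assms(2,3) by (intro sum.cong) auto
  finally show ?thesis
    using assms(1,2) by simp
qed

lemma altitude_orthogonal_edge:
  fixes v :: "'i \<Rightarrow> 'a::real_inner"
  assumes "finite I" "i \<notin> I" "j \<in> I" "k \<in> I"
    and eq: "\<And>p q. p \<in> insert i I \<Longrightarrow> q \<in> insert i I \<Longrightarrow> p \<noteq> q \<Longrightarrow> dist (v p) (v q) = l"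
  shows "(\<Sum>p\<in>I. v i - v p) \<bullet> (v j - v k) = 0"
proof -
  \<comment> \<open>Both distances are \<open>l\<close>, as \<open>i\<close> lies outside
    \<open>I\<close>. In \<open>inner_diff_diff\<close> they cancel, which leaves only distances
    between points of the face.\<close>
  have "dist (v i) (v k) = dist (v i) (v j)"
    using assms(2-4) by (metis eq insertCI)
  then have "(\<Sum>p\<in>I. v i - v p) \<bullet> (v j - v k) =
      (\<Sum>p\<in>I. ((dist (v p) (v j))\<^sup>2 - (dist (v p) (v k))\<^sup>2) / 2)"
    by (simp add: inner_sum_left inner_diff_diff)
  also have "\<dots> = ((\<Sum>p\<in>I. (dist (v p) (v j))\<^sup>2) - (\<Sum>p\<in>I. (dist (v p) (v k))\<^sup>2)) / 2"
    by (simp flip: sum_divide_distrib add: sum_subtractf)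
  also have "\<dots> = 0"
    using assms by (simp add: sum_dist_square_equidistant[where l = l])
  finally show ?thesis .
qed

text \<open>As \<open>i \<le> m\<close>, the face has exactly \<open>m\<close> vertices, so
  \<open>x\<close> is the average of \<open>m\<close> copies of itself.\<close>

lemma diff_face_barycenter:
  assumes "1 \<le> m" "i \<le> m"
  shows "x - face_barycenter m v i = (1 / real m) *\<^sub>R (\<Sum>p\<in>{..m} - {i}. x - v p)"
  using assms by (simp add: face_barycenter_def sum_subtractf scaleR_diff_right
      sum_constant_scaleR)

lemma pythagoras_inner_zero:
  fixes a b c :: "'a::real_inner"
  assumes "(a - c) \<bullet> (b - c) = 0"
  shows "(norm (a - c))\<^sup>2 + (norm (b - c))\<^sup>2 = (norm (a - b))\<^sup>2"
  using assms by (simp add: power2_norm_eq_inner inner_diff inner_commute)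

theorem theorem2p31:
  fixes v :: "nat \<Rightarrow> real ^ 'n" and \<sigma> :: "(real ^ 'n) set" and m :: nat
  assumes "1 \<le> m" and "m \<le> CARD('n)"
    and "regular_simplex_with_vertices m v \<sigma>"
  shows "\<forall>i\<le>m. \<forall>j\<le>m. j \<noteq> i \<longrightarrow>
    (norm (v i - face_barycenter m v i))\<^sup>2 + (norm (v j - face_barycenter m v i))\<^sup>2
      = (norm (v i - v j))\<^sup>2"
proof (intro allI impI)
  fix i j assume ij: "i \<le> m" "j \<le> m" "j \<noteq> i"
  obtain l where l: "\<And>p q. p \<le> m \<Longrightarrow> q \<le> m \<Longrightarrow> p \<noteq> q \<Longrightarrow> dist (v p) (v q) = l"
    using assms(3) by (auto simp: regular_simplex_with_vertices_def)
  have "(\<Sum>p\<in>{..m} - {i}. v i - v p) \<bullet> (v j - v k) = 0" if "k \<in> {..m} - {i}" for k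
    by (rule altitude_orthogonal_edge[where l = l]) (use that ij in \<open>auto intro: l\<close>)
  \<comment> \<open>Both differences become averages over the face: of \<open>v i - v p\<close> over
    \<open>p\<close>, and of \<open>v j - v k\<close> over \<open>k\<close>. Expanding the second
    one gives a sum over \<open>k\<close> of the zeros just found.\<close>
  then have "(v i - face_barycenter m v i) \<bullet> (v j - face_barycenter m v i) = 0"
    using assms(1) ij by (simp add: diff_face_barycenter inner_sum_right)
  then show "(norm (v i - face_barycenter m v i))\<^sup>2 + (norm (v j - face_barycenter m v i))\<^sup>2
      = (norm (v i - v j))\<^sup>2"
    by (rule pythagoras_inner_zero)
qed

end
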